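(* Let $k>0$, $y>0$, $w\ge 0$, and let $f:[0,\infty)\to(0,\infty)$ be the unique solution of $f''(t)=\dfrac{k}{f(t)}$, $t\ge 0$, with $f(0)=y$ and $f'(0)=w$. Then $$f(t)=t\sqrt{2k\ln t}\left(1+\mathcal{O}\left(\frac{\ln(\ln t)}{\ln t}\right)\right),\qquad t\to\infty .$$
   Context: The solution has the known representation $f(t)=c\,f_0(a+bt)$, where $f_0(x)=\exp(U(x)^2)$ for $x\ge 0$, $U(x)\ge 0$ is defined by $\int_0^{U(x)}\exp(u^2)\,du=x/\sqrt2$, and $a=\sqrt2\int_0^{w/\sqrt{2k}}\exp(u^2)\,du$, $b=\frac{\sqrt k}{y}\exp\left(\frac{w^2}{2k}\right)$, $c=y\exp\left(-\frac{w^2}{2k}\right)$. *)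

theory Defs
  imports Complex_Main "HOL-Library.Landau_Symbols"
begin

text \<open>
  A function on \<open>[0, \<infinity>)\<close> is a total function of which only the values on \<open>{0..}\<close> matter:
  derivatives are taken within \<open>{0..}\<close>, so they are one-sided at \<open>0\<close> and two-sided at every
  \<open>t > 0\<close>. On \<open>{0..}\<close> the witness \<open>f'\<close> is uniquely determined by \<open>f\<close>.
\<close>

definition ivp_solution :: "real \<Rightarrow> real \<Rightarrow> real \<Rightarrow> (real \<Rightarrow> real) \<Rightarrow> bool" where
  "ivp_solution k y w f \<longleftrightarrow>
     (\<forall>t\<ge>0. f t > 0) \<and>
     (\<exists>f'. (\<forall>t\<ge>0. (f has_real_derivative f' t) (at t within {0..})) \<and>
           (\<forall>t\<ge>0. (f' has_real_derivative k / f t) (at t within {0..})) \<and>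
           f 0 = y \<and> f' 0 = w)"

end

theory Submission
  imports Defs "HOL-Real_Asymp.Real_Asymp"
begin

text \<open>
  Write \<open>p = f'\<close>. The energy \<open>p\<^sup>2 - 2 k ln f\<close> is conserved, and \<open>(f / p)' = 1 - k / p\<^sup>2\<close>.
  The correction \<open>f / p \<cdot> (1 + 2 k / p\<^sup>2)\<close> has derivative \<open>1 + k / p\<^sup>2 - 6 k\<^sup>2 / p\<^sup>4\<close>, which is
  at least \<open>1\<close> once \<open>p\<close> is large. So \<open>t\<close> is, up to additive constants, squeezed between
  \<open>f / p\<close> and its correction, whence \<open>f = t p (1 + O(1 / p\<^sup>2))\<close>. Taking logarithms gives
  \<open>ln f = ln t + O(ln ln t)\<close>, and conservation of energy turns this into
  \<open>p = sqrt (2 k ln t) (1 + O(ln ln t / ln t))\<close>.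
\<close>

text \<open>Time starts at 1 because \<open>w = 0\<close> is allowed: the slope may vanish at 0,
  which would spoil quotients by \<open>p\<close>. From 1 on the slope is positive and derivatives
  are two-sided.\<close>

locale positive_solution =
  fixes k :: real and f p :: "real \<Rightarrow> real"
  assumes k_pos: "k > 0"
    and f_pos: "t \<ge> 1 \<Longrightarrow> f t > 0"
    and p_1_pos: "p 1 > 0"
    and f_deriv: "t \<ge> 1 \<Longrightarrow> (f has_real_derivative p t) (at t)"
    and p_deriv: "t \<ge> 1 \<Longrightarrow> (p has_real_derivative k / f t) (at t)"
begin

section \<open>Monotone slope and conservation of energy\<close>

lemma p_mono:
  assumes "1 \<le> s" "s \<le> t"
  shows "p s \<le> p t"
proof (rule DERIV_nonneg_imp_nondecreasing[OF assms(2)])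
  fix x assume "s \<le> x" "x \<le> t"
  then have "x \<ge> 1" using assms by simp
  then show "\<exists>y. DERIV p x :> y \<and> 0 \<le> y"
    using p_deriv f_pos k_pos by (meson divide_nonneg_pos less_imp_le)
qed

lemma p_pos: "t \<ge> 1 \<Longrightarrow> p t > 0"
  using p_mono[of 1 t] p_1_pos by simp

definition energy :: real where
  "energy = (p 1)\<^sup>2 - 2 * k * ln (f 1)"

lemma p_squared:
  assumes "t \<ge> 1"
  shows "(p t)\<^sup>2 = 2 * k * ln (f t) + energy"
proof -
  define g where "g = (\<lambda>t. (p t)\<^sup>2 - 2 * k * ln (f t))"
  \<comment> \<open>Both terms of \<open>g\<close> have derivative
    \<open>2 * k * p x / f x\<close>.\<close>
  have deriv: "(g has_real_derivative 0) (at x)" if "1 \<le> x" for x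
    unfolding g_def using f_pos[OF that]
    by (auto intro!: derivative_eq_intros f_deriv[OF that] p_deriv[OF that] simp: field_simps)
  have "g 1 \<le> g t" "g t \<le> g 1"
    using deriv
    by (blast intro: DERIV_nonneg_imp_nondecreasing[OF assms]
        DERIV_nonpos_imp_nonincreasing[OF assms])+
  then show ?thesis by (simp add: energy_def g_def)
qed

section \<open>Crude bounds on the solution and its slope\<close>

lemma f_lower:
  assumes "t \<ge> 1"
  shows "f t \<ge> p 1 * (t - 1)"
proof -
  have "f 1 - p 1 * 1 \<le> f t - p 1 * t"
  proof (rule DERIV_nonneg_imp_nondecreasing[OF assms])
    fix x :: real assume x: "1 \<le> x" "x \<le> t"
    have "((\<lambda>t. f t - p 1 * t) has_real_derivative p x - p 1) (at x)"
      by (auto intro!: derivative_eq_intros f_deriv[OF x(1)])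
    then show "\<exists>y. ((\<lambda>t. f t - p 1 * t) has_real_derivative y) (at x) \<and> 0 \<le> y"
      using p_mono[of 1 x] x by fastforce
  qed
  then show ?thesis using f_pos[of 1] by (simp add: algebra_simps)
qed

text \<open>The quotient \<open>f / p\<close> has derivative \<open>1 - k / p\<^sup>2\<close>, which
  is at most 1. The integration constant \<open>f 1 / p 1 - 1\<close> is rounded up to the positive
  \<open>f 1 / p 1\<close>.\<close>

lemma f_upper:
  assumes "t \<ge> 1"
  shows "f t \<le> p t * (t + f 1 / p 1)"
proof -
  have "f t / p t - t \<le> f 1 / p 1 - 1"
  proof (rule DERIV_nonpos_imp_nonincreasing[OF assms])
    fix x :: real assume x: "1 \<le> x" "x \<le> t"
    have "((\<lambda>t. f t / p t - t) has_real_derivative - (k / (p x)\<^sup>2)) (at x)"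
      using p_pos[OF x(1)] f_pos[OF x(1)]
      by (auto intro!: derivative_eq_intros f_deriv[OF x(1)] p_deriv[OF x(1)]
          simp: field_simps power2_eq_square)
    then show "\<exists>y. ((\<lambda>t. f t / p t - t) has_real_derivative y) (at x) \<and> y \<le> 0"
      using k_pos by (intro exI[of _ "- (k / (p x)\<^sup>2)"]) auto
  qed
  then show ?thesis using p_pos[OF assms] by (simp add: field_simps)
qed

lemma ln_f_lower: "\<forall>\<^sub>F t in at_top. ln (f t) \<ge> ln t - ln (2 / p 1)"
  using eventually_ge_at_top[of 2]
proof eventually_elim
  case (elim t)
  have "t * (p 1 / 2) \<le> p 1 * (t - 1)" using elim p_1_pos by (simp add: field_simps)
  also have "\<dots> \<le> f t" using f_lower elim by simp
  finally have "ln (t * (p 1 / 2)) \<le> ln (f t)" using elim p_1_pos by (intro ln_mono) auto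
  then show ?case using elim p_1_pos by (simp add: ln_mult ln_div)
qed

text \<open>The energy identity provides the leading coefficient \<open>2 * k\<close>; giving up
  half of it absorbs every additive constant.\<close>

lemma p_squared_lower: "\<forall>\<^sub>F t in at_top. (p t)\<^sup>2 \<ge> k * ln t"
proof -
  have "\<forall>\<^sub>F t in at_top. 2 * k * (ln t - ln (2 / p 1)) + E \<ge> k * ln t" for E
    using k_pos by real_asymp
  from this[of energy] ln_f_lower eventually_ge_at_top[of 1] show ?thesis
  proof eventually_elim
    case (elim t)
    then have "2 * k * (ln t - ln (2 / p 1)) \<le> 2 * k * ln (f t)"
      using k_pos by (intro mult_left_mono) auto
    then show ?case using p_squared[of t] elim by linarith
  qed
qed

lemma f_at_top: "filterlim f at_top at_top"
proof (rule filterlim_at_top_mono)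
  show "filterlim (\<lambda>t. p 1 * (t - 1)) at_top at_top" using p_1_pos by real_asymp
  show "\<forall>\<^sub>F t in at_top. p 1 * (t - 1) \<le> f t"
    using eventually_ge_at_top[of 1] by eventually_elim (rule f_lower)
qed

text \<open>This breaks the circularity between bounding \<open>f\<close> by \<open>p\<close> and
  \<open>p\<close> by \<open>ln f\<close>. Since \<open>f\<close> tends to infinity,
  \<open>p\<^sup>2 = 2 * k * ln f + energy\<close> is eventually at most \<open>f\<close>; squaring
  \<open>f_upper\<close> and cancelling one factor \<open>f\<close> leaves a quadratic bound in
  \<open>t\<close>.\<close>

lemma f_le_square: "\<forall>\<^sub>F t in at_top. f t \<le> (t + f 1 / p 1)\<^sup>2"
proof -
  have "\<forall>\<^sub>F x in at_top. 2 * k * ln x + E \<le> x" for E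
    using k_pos by real_asymp
  from this[of energy] have "\<forall>\<^sub>F t in at_top. 2 * k * ln (f t) + energy \<le> f t"
    by (rule eventually_compose_filterlim[OF _ f_at_top])
  with eventually_ge_at_top[of 1] show ?thesis
  proof eventually_elim
    case (elim t)
    note pos = f_pos[of t] p_pos[of t] f_pos[of 1] p_1_pos
    have "(f t)\<^sup>2 \<le> (p t * (t + f 1 / p 1))\<^sup>2"
      using f_upper[of t] elim pos by (intro power_mono) auto
    also have "\<dots> \<le> f t * (t + f 1 / p 1)\<^sup>2"
      unfolding power_mult_distrib using elim p_squared[of t] by (intro mult_right_mono) auto
    finally show ?case using pos elim by (simp add: power2_eq_square)
  qed
qed

text \<open>The quadratic bound on \<open>f\<close> yields leading coefficient \<open>4 * k\<close>;
  the excess of 5 over 4 absorbs the shift of \<open>t\<close> and the energy.\<close>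

lemma p_squared_upper: "\<forall>\<^sub>F t in at_top. (p t)\<^sup>2 \<le> 5 * k * ln t"
proof -
  have "\<forall>\<^sub>F t in at_top. 2 * k * (2 * ln (t + f 1 / p 1)) + E \<le> 5 * k * ln t" for E
    using k_pos by real_asymp
  from this[of energy] f_le_square eventually_ge_at_top[of 1] show ?thesis
  proof eventually_elim
    case (elim t)
    have c: "f 1 / p 1 > 0" using f_pos p_1_pos by simp
    have "ln (f t) \<le> ln ((t + f 1 / p 1)\<^sup>2)"
      using elim f_pos[of t] c by (intro ln_mono) auto
    also have "\<dots> = 2 * ln (t + f 1 / p 1)"
      using elim c by (simp add: ln_realpow)
    finally have "2 * k * ln (f t) \<le> 2 * k * (2 * ln (t + f 1 / p 1))"
      using k_pos by (intro mult_left_mono) auto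
    then show ?case using p_squared[of t] elim by linarith
  qed
qed

text \<open>Taking logarithms in \<open>f_upper\<close>, the slope contributes only about half of
  \<open>ln (ln t)\<close>; the other half absorbs the constants.\<close>

lemma ln_f_upper: "\<forall>\<^sub>F t in at_top. ln (f t) \<le> ln t + ln (ln t)"
proof -
  have "\<forall>\<^sub>F t in at_top. ln (5 * k * ln t) / 2 + ln (t + f 1 / p 1) \<le> ln t + ln (ln t)"
    using k_pos by real_asymp
  with p_squared_upper eventually_ge_at_top[of 1] show ?thesis
  proof eventually_elim
    case (elim t)
    have c: "f 1 / p 1 > 0" using f_pos p_1_pos by simp
    have p: "p t > 0" using p_pos elim by simp
    have "2 * ln (p t) = ln ((p t)\<^sup>2)" using p by (simp add: ln_realpow)
    also have "\<dots> \<le> ln (5 * k * ln t)" using elim p by (intro ln_mono) auto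
    finally have "ln (p t) \<le> ln (5 * k * ln t) / 2" by simp
    moreover have "ln (f t) \<le> ln (p t * (t + f 1 / p 1))"
      using f_upper[of t] f_pos[of t] elim by (intro ln_mono) auto
    moreover have "\<dots> = ln (p t) + ln (t + f 1 / p 1)"
      using p elim c by (simp add: ln_mult)
    ultimately show ?case using elim by linarith
  qed
qed

section \<open>Relative errors of \<open>f / (t * p)\<close> and of \<open>p\<close>\<close>

lemma f_over_p_lower:
  obtains c where "\<forall>\<^sub>F t in at_top. t - c \<le> f t / p t * (1 + 2 * k / (p t)\<^sup>2)"
proof -
  \<comment> \<open>The threshold \<open>6 * k\<close> is where the derivative of \<open>H\<close>
    below becomes nonnegative.\<close>
  have "\<forall>\<^sub>F t in at_top. 6 * k \<le> k * ln t" using k_pos by real_asymp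
  with p_squared_lower have "\<forall>\<^sub>F t in at_top. 6 * k \<le> (p t)\<^sup>2"
    by eventually_elim linarith
  then obtain T' where T': "6 * k \<le> (p t)\<^sup>2" if "t \<ge> T'" for t
    by (auto simp: eventually_at_top_linorder)
  define T where "T = max 1 T'"
  \<comment> \<open>To leading order the correction \<open>2 * k * f / p ^ 3\<close> adds
    \<open>2 * k / p\<^sup>2\<close> to the derivative, outweighing the deficit
    \<open>k / p\<^sup>2\<close> of \<open>f / p\<close>.\<close>
  define H where "H = (\<lambda>t. f t / p t * (1 + 2 * k / (p t)\<^sup>2) - t)"
  have "H T \<le> H t" if "T \<le> t" for t
  proof (rule DERIV_nonneg_imp_nondecreasing[OF that])
    fix x assume "T \<le> x" "x \<le> t"
    then have x: "1 \<le> x" and large: "6 * k \<le> (p x)\<^sup>2" using T' by (auto simp: T_def)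
    note pos = p_pos[OF x] f_pos[OF x]
    have "(H has_real_derivative k * ((p x)\<^sup>2 - 6 * k) / (p x) ^ 4) (at x)"
      unfolding H_def using pos
      by (auto intro!: derivative_eq_intros f_deriv[OF x] p_deriv[OF x])
        (simp add: divide_simps power2_eq_square power4_eq_xxxx, simp add: algebra_simps)
    moreover have "k * ((p x)\<^sup>2 - 6 * k) / (p x) ^ 4 \<ge> 0"
      using large k_pos by simp
    ultimately show "\<exists>y. (H has_real_derivative y) (at x) \<and> 0 \<le> y" by blast
  qed
  then have "\<forall>\<^sub>F t in at_top. t - (- H T) \<le> f t / p t * (1 + 2 * k / (p t)\<^sup>2)"
    by (intro eventually_mono[OF eventually_ge_at_top[of T]]) (force simp: H_def)
  then show ?thesis by (rule that)
qed

text \<open>Of the constant 3, one unit pays for the additive constant divided by \<open>t\<close>,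
  and two pay for the correction \<open>2 * k / p\<^sup>2\<close>, by
  \<open>p_squared_lower\<close>. The upper estimate needs just one unit.\<close>

lemma f_over_t_p: "\<forall>\<^sub>F t in at_top. \<bar>f t / (t * p t) - 1\<bar> \<le> 3 * (1 / ln t)"
proof -
  obtain c where c: "\<forall>\<^sub>F t in at_top. t - c \<le> f t / p t * (1 + 2 * k / (p t)\<^sup>2)"
    by (rule f_over_p_lower)
  have "\<forall>\<^sub>F t in at_top. c / t \<le> 1 / ln t" "\<forall>\<^sub>F t in at_top. f 1 / p 1 / t \<le> 1 / ln t"
    by real_asymp+
  with c p_squared_lower eventually_ge_at_top[of "exp 1"] show ?thesis
  proof eventually_elim
    case (elim t)
    define q where "q = f t / (t * p t)"
    define e where "e = 1 / ln t"
    define d where "d = 2 * k / (p t)\<^sup>2"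
    have "exp 1 \<ge> (2::real)" using exp_ge_add_one_self[of 1] by simp
    then have t: "t > 1" "ln t \<ge> 1" using elim ln_ge_iff[of t 1] by linarith+
    then have t1: "t \<ge> 1" by simp
    note pos = p_pos[OF t1] f_pos[OF t1]
    have q: "q > 0" using pos t by (simp add: q_def)
    have "d \<le> 2 * k / (k * ln t)"
      unfolding d_def using elim k_pos t pos by (intro divide_left_mono) auto
    then have d: "0 \<le> d" "d \<le> 2 * e"
      using k_pos by (auto simp: d_def e_def)
    have e: "e > 0" using t by (simp add: e_def)
    have "q \<le> 1 + f 1 / p 1 / t"
      using f_upper[OF t1] pos t by (simp add: q_def field_simps)
    then have upper: "q \<le> 1 + e" using elim by (simp add: e_def)
    have "(t - c) / t \<le> f t / p t * (1 + d) / t"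
      using elim t unfolding d_def by (intro divide_right_mono) auto
    then have "1 - c / t \<le> q * (1 + d)" using t by (simp add: q_def field_simps)
    then have lower: "1 - e \<le> q * (1 + d)" using elim by (simp add: e_def)
    have "q \<ge> 1 - 3 * e"
    \<comment> \<open>Bounding the error \<open>q * d\<close> by \<open>2 * e\<close> uses
      \<open>q \<le> 1\<close>; for larger \<open>q\<close> the lower bound is immediate.\<close>
    proof (cases "q \<le> 1")
      case True
      then have "q * d \<le> 1 * (2 * e)" using d q by (intro mult_mono) auto
      with lower show ?thesis by (simp add: algebra_simps)
    qed (use e in simp)
    with upper e show ?case by (simp add: q_def e_def abs_le_iff)
  qed
qed

text \<open>By the energy identity the squared ratio deviates from 1 by \<open>ln f - ln t\<close>
  plus a constant, divided by \<open>ln t\<close>. Each of the two summands costs at most one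
  \<open>ln (ln t)\<close>.\<close>

lemma p_over_sqrt:
  "\<forall>\<^sub>F t in at_top. \<bar>p t / sqrt (2 * k * ln t) - 1\<bar> \<le> 2 * (ln (ln t) / ln t)"
proof -
  define E where "E = \<bar>energy / (2 * k)\<bar>"
  have "\<forall>\<^sub>F t in at_top. ln (2 / p 1) \<le> ln (ln t)" "\<forall>\<^sub>F t in at_top. E \<le> ln (ln t)"
    by real_asymp+
  with ln_f_lower ln_f_upper eventually_ge_at_top[of "exp 1"] show ?thesis
  proof eventually_elim
    case (elim t)
    have "exp 1 \<ge> (2::real)" using exp_ge_add_one_self[of 1] by simp
    then have t: "t > 1" "ln t \<ge> 1" using elim ln_ge_iff[of t 1] by linarith+
    then have t1: "t \<ge> 1" by simp
    define s where "s = p t / sqrt (2 * k * ln t)"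
    have s: "s \<ge> 0" using p_pos[OF t1] t k_pos by (simp add: s_def)
    have "s\<^sup>2 = (2 * k * ln (f t) + energy) / (2 * k * ln t)"
      using p_squared[OF t1] t k_pos by (simp add: s_def power_divide)
    then have "s\<^sup>2 - 1 = (ln (f t) - ln t + energy / (2 * k)) / ln t"
      using t k_pos by (simp add: divide_simps) (simp add: algebra_simps)
    moreover have "\<bar>ln (f t) - ln t + energy / (2 * k)\<bar> \<le> 2 * ln (ln t)"
    proof -
      have "\<bar>energy / (2 * k)\<bar> \<le> ln (ln t)" using elim by (simp only: E_def)
      then show ?thesis using elim by linarith
    qed
    ultimately have "\<bar>s\<^sup>2 - 1\<bar> \<le> 2 * (ln (ln t) / ln t)"
      using t by (simp add: abs_divide divide_right_mono)
    moreover have "\<bar>s\<^sup>2 - 1\<bar> = \<bar>s - 1\<bar> * (s + 1)"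
      using s by (simp add: power2_eq_square square_diff_one_factored abs_mult)
    \<comment> \<open>The square root is removed without loss in the constant, because
      \<open>s + 1\<close> is at least 1.\<close>
    moreover have "\<bar>s - 1\<bar> * 1 \<le> \<bar>s - 1\<bar> * (s + 1)"
      using s by (intro mult_left_mono) auto
    ultimately show ?case by (simp add: s_def)
  qed
qed

section \<open>Combining the two relative errors\<close>

lemma relative_error_bigo:
  "(\<lambda>t. f t / (t * sqrt (2 * k * ln t)) - 1) \<in> O[at_top](\<lambda>t. ln (ln t) / ln t)"
proof -
  define q where "q = (\<lambda>t. f t / (t * p t) - 1)"
  define s where "s = (\<lambda>t. p t / sqrt (2 * k * ln t) - 1)"
  let ?g = "\<lambda>t::real. ln (ln t) / ln t"
  have "q \<in> O[at_top](\<lambda>t. 1 / ln t)"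
  proof (rule bigoI[of _ 3])
    show "\<forall>\<^sub>F t in at_top. norm (q t) \<le> 3 * norm (1 / ln t)"
      using f_over_t_p
    proof eventually_elim
      case (elim t)
      then show ?case
        unfolding q_def real_norm_def using abs_ge_self[of "1 / ln t"] by linarith
    qed
  qed
  also have "(\<lambda>t::real. 1 / ln t) \<in> O[at_top](?g)" by real_asymp
  finally have q: "q \<in> O[at_top](?g)" .
  have s: "s \<in> O[at_top](?g)"
  proof (rule bigoI[of _ 2])
    show "\<forall>\<^sub>F t in at_top. norm (s t) \<le> 2 * norm (?g t)"
      using p_over_sqrt
    proof eventually_elim
      case (elim t)
      then show ?case
        unfolding s_def real_norm_def using abs_ge_self[of "ln (ln t) / ln t"] by linarith
    qed
  qed
  \<comment> \<open>Weakening \<open>s\<close> to a bounded function makes the cross term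
    \<open>q * s\<close> as small as \<open>q\<close>.\<close>
  also have "?g \<in> O[at_top](\<lambda>_. 1)" by real_asymp
  finally have "(\<lambda>t. q t * s t) \<in> O[at_top](\<lambda>t. ?g t * 1)"
    using q by (intro landau_o.big.mult)
  then have "(\<lambda>t. q t * s t + q t + s t) \<in> O[at_top](?g)"
    using q s by (intro sum_in_bigo) simp_all
  \<comment> \<open>The total error is \<open>(1 + q) * (1 + s) - 1\<close>, since the slope cancels
    in the product of the two ratios.\<close>
  moreover have "\<forall>\<^sub>F t in at_top.
      q t * s t + q t + s t = f t / (t * sqrt (2 * k * ln t)) - 1"
    using eventually_gt_at_top[of 1]
  proof eventually_elim
    case (elim t)
    then have "p t > 0" by (simp add: p_pos)
    then have "f t / (t * sqrt (2 * k * ln t)) = (q t + 1) * (s t + 1)"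
      by (simp add: q_def s_def)
    then show ?case by (simp add: algebra_simps)
  qed
  ultimately show ?thesis by (simp cong: landau_o.big.in_cong)
qed

end

section \<open>Passage from the initial value problem to times after 1\<close>

lemma ivp_solution_positive_solution:
  assumes "k > 0" "w \<ge> 0" "ivp_solution k y w f"
  shows "\<exists>p. positive_solution k f p"
proof -
  obtain p where f: "\<And>t. t \<ge> 0 \<Longrightarrow> f t > 0"
    and df: "\<And>t. t \<ge> 0 \<Longrightarrow> (f has_real_derivative p t) (at t within {0..})"
    and dp: "\<And>t. t \<ge> 0 \<Longrightarrow> (p has_real_derivative k / f t) (at t within {0..})"
    and p0: "p 0 = w"
    using assms(3) unfolding ivp_solution_def by blast
  have at: "at t within {0..} = at t" if "t > 0" for t :: real
    using that by (intro at_within_open_subset[of t "{0<..}"]) auto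
  have df1: "(f has_real_derivative p t) (at t)" if "t \<ge> 1" for t
    using df[of t] at[of t] that by simp
  have dp1: "(p has_real_derivative k / f t) (at t)" if "t \<ge> 1" for t
    using dp[of t] at[of t] that by simp
  have "p 0 < p 1"
  \<comment> \<open>The derivative at 0 is only one-sided, so the sign of \<open>k / f\<close> is
    used on the open interval and mere continuity at the endpoints. Strict growth gives
    \<open>p 1 > 0\<close> even when \<open>w = 0\<close>.\<close>
  proof (rule DERIV_pos_imp_increasing_open[of 0 1 p])
    fix x :: real assume "0 < x" "x < 1"
    then show "\<exists>y. DERIV p x :> y \<and> y > 0"
      using dp[of x] at[of x] f[of x] assms(1) by (metis divide_pos_pos less_imp_le)
  next
    have "continuous_on {0..} p" using dp by (intro DERIV_continuous_on) auto
    then show "continuous_on {0..1} p" by (rule continuous_on_subset) auto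
  qed simp
  then have "positive_solution k f p"
    using assms(1,2) f p0 df1 dp1 by unfold_locales auto
  then show ?thesis by blast
qed

theorem corollary3p1:
  fixes k y w :: real and f :: "real \<Rightarrow> real"
  assumes "k > 0" and "y > 0" and "w \<ge> 0"
    and "ivp_solution k y w f"
  shows "\<exists>r :: real \<Rightarrow> real. r \<in> O[at_top](\<lambda>t. ln (ln t) / ln t) \<and>
           (\<forall>\<^sub>F t in at_top. f t = t * sqrt (2 * k * ln t) * (1 + r t))"
proof -
  obtain p where "positive_solution k f p"
    using ivp_solution_positive_solution assms by blast
  then interpret positive_solution k f p .
  \<comment> \<open>The witness \<open>r\<close> is the relative error itself; for
    \<open>t > 1\<close> its denominator is nonzero.\<close>
  have "\<forall>\<^sub>F t in at_top.
      f t = t * sqrt (2 * k * ln t) * (1 + (f t / (t * sqrt (2 * k * ln t)) - 1))"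
    using eventually_gt_at_top[of 1] by eventually_elim (use assms(1) in simp)
  then show ?thesis using relative_error_bigo by blast
qed

end
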